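(* Let $p$ be an odd prime number. If $n_1$ and $n_2$ are integers greater than $8$ such that $\mathbb{Q}(\sqrt{1-4p^{n_1}})=\mathbb{Q}(\sqrt{1-4p^{n_2}})$, then $n_1=n_2$. *)

theory Defs
  imports Complex_Main
    "HOL-Algebra.Algebraic_Closure_Type"
    "HOL-Algebra.Generated_Fields"
begin

text \<open>The field \<open>\<rat>(x)\<close>, as a subfield of the complex numbers.\<close>

definition rat_adjoin :: "complex \<Rightarrow> complex set" where
  "rat_adjoin x = generate_field ring_of_type_algebra (\<rat> \<union> {x})"

text \<open>The field \<open>\<rat>(\<surd>d)\<close> for an integer \<open>d\<close>, possibly negative. It does not depend on
  which square root of \<open>d\<close> is adjoined; we take the principal one.\<close>

definition quadratic_field :: "int \<Rightarrow> complex set" where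
  "quadratic_field d = rat_adjoin (csqrt (of_int d))"

end

(* If the two fields agree, then 4 p^n - 1 = g a^2 and 4 p^k - 1 = g b^2 for a common g, where
   k < n, say. Thus \<alpha> = (1 + a sqrt(-g)) / 2 and \<beta> = (1 + b sqrt(-g)) / 2 have trace 1 and norms p^n and
   p^k. After choosing conjugates, the same prime P above p divides both, so \<alpha>^k / \<beta>^n is a unit,
   hence a 12th root of unity. Conjugating gives (1 - \<alpha>)^(12 k) = (1 - \<beta>)^(12 n). The left side is
   1 modulo P^n, whereas \<beta> has P-adic valuation exactly k, so lifting the exponent shows that
   p^(n - k) divides 12 n. On the other hand a^2 and b^2 agree modulo p^k, so p^k <= a + b, and hence n is
   not much smaller than 2 k. For k > 8 these two facts contradict each other. *)

theory Submission
  imports Defs "HOL-Number_Theory.Cong"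
begin

section \<open>Equality of imaginary quadratic fields\<close>

text \<open>The complex numbers with rational real part and imaginary part in the rational line
  through \<open>S\<close> form a field. As \<open>S^2\<close> is a nonzero rational, membership in
  that line can be tested by multiplying with \<open>S\<close>, which avoids naming a rational
  coefficient in the induction.\<close>

lemma rat_adjoin_imaginary_quadratic:
  fixes S :: real
  assumes "S\<^sup>2 \<in> \<rat>" "S \<noteq> 0" "z \<in> rat_adjoin (\<i> * of_real S)"
  shows "Re z \<in> \<rat> \<and> Im z * S \<in> \<rat>"
proof -
  interpret field "ring_of_type_algebra :: complex ring"
    by (rule field_from_type_algebra)
  have carrier: "carrier (ring_of_type_algebra :: complex ring) = UNIV"
    and mult: "x \<otimes>\<^bsub>ring_of_type_algebra\<^esub> y = x * y"
    and add: "x \<oplus>\<^bsub>ring_of_type_algebra\<^esub> y = x + y"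
    and zero: "\<zero>\<^bsub>ring_of_type_algebra\<^esub> = (0::complex)"
    and one: "\<one>\<^bsub>ring_of_type_algebra\<^esub> = (1::complex)" for x y :: complex
    by (auto simp: ring_of_type_algebra_def)
  have a_inv: "\<ominus>\<^bsub>ring_of_type_algebra\<^esub> x = - x" for x :: complex
    by (rule minus_equality) (auto simp: carrier add zero)
  have m_inv: "inv\<^bsub>ring_of_type_algebra\<^esub> x = inverse x" if "x \<noteq> 0" for x :: complex
    by (rule comm_inv_char) (use that in \<open>auto simp: carrier mult one\<close>)
  have im_mult: "Im x * Im y \<in> \<rat>" if "Im x * S \<in> \<rat>" "Im y * S \<in> \<rat>" for x y
  proof -
    have "Im x * Im y = (Im x * S) * (Im y * S) / S\<^sup>2"
      using \<open>S \<noteq> 0\<close> by (simp add: power2_eq_square)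
    then show ?thesis using that assms(1) by simp
  qed
  show ?thesis using assms(3) unfolding rat_adjoin_def
  proof (induction z rule: generate_field.induct)
    case one
    then show ?case by (simp add: \<open>\<one>\<^bsub>_\<^esub> = _\<close>)
  next
    case (incl h)
    then consider "h \<in> \<rat>" | "h = \<i> * of_real S" by blast
    then show ?case
    proof cases
      case 1
      then obtain r where "h = of_rat r" by (rule Rats_cases)
      then obtain i j :: int where "h = of_int i / of_int j"
        by (cases r) (simp add: of_rat_rat)
      then have "h = of_real (of_int i / of_int j)" by simp
      then show ?thesis by (simp only: Re_complex_of_real Im_complex_of_real) simp
    next
      case 2
      then show ?thesis using assms(1) by (simp add: power2_eq_square)
    qed
  next
    case (a_inv h)
    then show ?case by (simp add: \<open>\<And>x. \<ominus>\<^bsub>_\<^esub> x = _\<close>)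
  next
    case (m_inv h)
    have norm: "(Re h)\<^sup>2 + (Im h)\<^sup>2 \<in> \<rat>"
      using m_inv.IH im_mult[of h h] by (simp add: power2_eq_square)
    have inv: "inv\<^bsub>ring_of_type_algebra\<^esub> h = inverse h"
      using m_inv zero by (intro \<open>\<And>x. x \<noteq> 0 \<Longrightarrow> inv\<^bsub>_\<^esub> x = _\<close>) simp
    have "Im (inverse h) * S = - (Im h * S) / ((Re h)\<^sup>2 + (Im h)\<^sup>2)"
      by (simp add: inverse_complex.sel)
    moreover have "- (Im h * S) / ((Re h)\<^sup>2 + (Im h)\<^sup>2) \<in> \<rat>"
      using norm m_inv.IH by (intro Rats_divide) (simp_all add: Rats_minus_iff)
    ultimately have "Im (inverse h) * S \<in> \<rat>" by simp
    moreover have "Re (inverse h) \<in> \<rat>"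
      unfolding inverse_complex.sel using norm m_inv.IH by (intro Rats_divide) simp_all
    ultimately show ?case by (simp only: inv)
  next
    case (eng_add x y)
    then show ?case by (simp add: add algebra_simps)
  next
    case (eng_mult x y)
    have "Im (x * y) * S = Re x * (Im y * S) + Re y * (Im x * S)"
      by (simp add: algebra_simps)
    then have "Im (x * y) * S \<in> \<rat>" using eng_mult by simp
    then show ?case using eng_mult im_mult[of x y] by (simp add: mult)
  qed
qed

text \<open>One inclusion suffices: the root of \<open>-E\<close> is an element of the field
  generated by the root of \<open>-D\<close>, and its imaginary part is
  \<open>sqrt E\<close>.\<close>

lemma quadratic_field_eq_imp_Rats:
  fixes D E :: int
  assumes "D > 0" "E > 0" "quadratic_field (- D) = quadratic_field (- E)"
  shows "sqrt (of_int D) * sqrt (of_int E) \<in> \<rat>"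
proof -
  have root: "csqrt (of_int (- Z)) = \<i> * of_real (sqrt (of_int Z))" if "Z > 0" for Z :: int
    using that by simp
  have "csqrt (of_int (- E)) \<in> quadratic_field (- E)"
    unfolding quadratic_field_def rat_adjoin_def by (auto intro: generate_field.incl)
  then have "\<i> * of_real (sqrt (of_int E)) \<in> rat_adjoin (\<i> * of_real (sqrt (of_int D)))"
    using assms root unfolding quadratic_field_def by metis
  from rat_adjoin_imaginary_quadratic[OF _ _ this] show ?thesis
    using assms by (simp add: mult.commute)
qed

lemma Rats_sqrt_mult_sqrt_imp_common_factor:
  fixes D E :: int
  assumes "D > 0" "E > 0" "sqrt (of_int D) * sqrt (of_int E) \<in> \<rat>"
  obtains g a b :: int where "D = g * a\<^sup>2" "E = g * b\<^sup>2" "a > 0" "b > 0"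
proof -
  \<comment> \<open>This quotient is the square root of \<open>D / E\<close>. Writing it as
    \<open>m / n\<close> in lowest terms makes \<open>m^2\<close> divide \<open>D\<close>, and the
    cofactor is the required \<open>g\<close>.\<close>
  have "sqrt (of_int D) * sqrt (of_int E) / of_int E \<in> \<rat>" using assms by simp
  then obtain m n :: nat where n: "n \<noteq> 0" and cop: "coprime m n"
    and mn: "\<bar>sqrt (of_int D) * sqrt (of_int E) / of_int E\<bar> = real m / real n"
    by (rule Rats_abs_nat_div_natE)
  have "(sqrt (of_int D) * sqrt (of_int E) / of_int E)\<^sup>2 = (real m / real n)\<^sup>2"
    by (simp only: mn[symmetric] power2_abs)
  then have "of_int D / of_int E = (real m)\<^sup>2 / (real n)\<^sup>2"
    using assms by (simp add: power_mult_distrib power_divide) (simp add: power2_eq_square)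
  then have "of_int D * (real n)\<^sup>2 = of_int E * (real m)\<^sup>2"
    using assms n by (simp add: field_simps)
  then have "real_of_int (D * (int n)\<^sup>2) = real_of_int (E * (int m)\<^sup>2)" by simp
  then have eq: "D * (int n)\<^sup>2 = E * (int m)\<^sup>2" by (simp only: of_int_eq_iff)
  have cop2: "coprime ((int m)\<^sup>2) ((int n)\<^sup>2)" using cop by simp
  have "(int m)\<^sup>2 dvd D * (int n)\<^sup>2" using eq by simp
  then have "(int m)\<^sup>2 dvd D" using cop2 by (simp add: coprime_dvd_mult_left_iff)
  then obtain g where g: "D = (int m)\<^sup>2 * g" by (rule dvdE)
  have "m \<noteq> 0" using g assms by (intro notI) simp
  then have "E = g * (int n)\<^sup>2" using eq g by (simp add: ac_simps)
  then show ?thesis using that[of g "int m" "int n"] g n \<open>m \<noteq> 0\<close> by (simp add: ac_simps)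
qed

section \<open>Roots modulo prime powers and lifting the exponent\<close>

lemma root_mod_prime_power:
  fixes p q :: int
  assumes "p dvd q"
  shows "\<exists>A. p dvd A \<and> p ^ k dvd A\<^sup>2 - A + q"
proof (induction k)
  case 0
  show ?case by (intro exI[of _ 0]) simp
next
  case (Suc k)
  then obtain A where A: "p dvd A" "p ^ k dvd A\<^sup>2 - A + q" by blast
  \<comment> \<open>Fixed point iteration for A = A^2 + q. It gains a factor \<open>p\<close> each
    time, because \<open>A' + A\<close> is divisible by \<open>p\<close>.\<close>
  define A' where "A' = A\<^sup>2 + q"
  have "p dvd A'" using A assms by (simp add: A'_def power2_eq_square)
  moreover have "A'\<^sup>2 - A' + q = (A' + A) * (A\<^sup>2 - A + q)"
    by (simp add: A'_def algebra_simps power2_eq_square)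
  then have "p ^ Suc k dvd A'\<^sup>2 - A' + q"
    using A \<open>p dvd A'\<close> by (simp add: mult_dvd_mono)
  ultimately show ?case by blast
qed

text \<open>First order binomial expansion of each power. The factor 2 avoids halving k (k -
  1).\<close>

lemma geometric_sum_mod_square:
  fixes c x p :: int
  assumes "c = 1 + p * x"
  shows "[2 * (\<Sum>i<k. c ^ i) = 2 * int k + p * x * (int k * (int k - 1))] (mod p\<^sup>2)"
proof -
  have pow: "[c ^ i = 1 + int i * (p * x)] (mod p\<^sup>2)" for i
  proof (induction i)
    case (Suc i)
    have "[c * c ^ i = c * (1 + int i * (p * x))] (mod p\<^sup>2)"
      using Suc by (rule cong_scalar_left)
    also have "c * (1 + int i * (p * x)) = 1 + int (Suc i) * (p * x) + p\<^sup>2 * (int i * x\<^sup>2)"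
      by (simp add: assms algebra_simps power2_eq_square)
    also have "[\<dots> = 1 + int (Suc i) * (p * x)] (mod p\<^sup>2)" by (simp add: cong_iff_dvd_diff)
    finally show ?case by simp
  qed simp
  have "[2 * (\<Sum>i<k. c ^ i) = 2 * (\<Sum>i<k. 1 + int i * (p * x))] (mod p\<^sup>2)"
    by (intro cong_scalar_left cong_sum pow)
  also have "2 * (\<Sum>i<k. 1 + int i * (p * x)) = 2 * int k + p * x * (int k * (int k - 1))"
    by (induction k) (simp_all add: algebra_simps)
  finally show ?thesis .
qed

text \<open>Lifting the exponent, stated for (c^k - 1) / (c - 1) as a sum so that
  \<open>c = 1\<close> is allowed. The induction removes one factor \<open>p\<close> from
  \<open>k\<close>: the sum splits into one of length \<open>p\<close>, divisible by
  \<open>p\<close> exactly once, and one of length \<open>k / p\<close> with ratio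
  \<open>c ^ p\<close>.\<close>

lemma prime_power_dvd_geometric_sum:
  fixes p k :: nat and c :: int
  assumes "Factorial_Ring.prime p" "odd p" "int p dvd c - 1" "int p ^ d dvd (\<Sum>i<k. c ^ i)"
  shows "p ^ d dvd k"
  using assms(3,4)
proof (induction d arbitrary: c k)
  case (Suc d)
  have prime: "Factorial_Ring.prime (int p)" and "p > 2"
    using assms by (simp, metis even_numeral nat_less_le prime_ge_2_nat)
  have "[(\<Sum>i<k. c ^ i) = (\<Sum>i<k. 1 ^ i)] (mod int p)"
    using Suc.prems by (intro cong_sum cong_pow) (simp add: cong_iff_dvd_diff)
  moreover have "int p dvd (\<Sum>i<k. c ^ i)"
    using Suc.prems(2) by (metis dvd_mult_left power_Suc)
  ultimately have "int p dvd int k" by (simp add: cong_dvd_iff)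
  then obtain k' where k: "k = p * k'" by (auto elim: dvdE)
  show ?case
  \<comment> \<open>The splitting is proved by cancelling \<open>c - 1\<close>; for
    \<open>c = 1\<close> the sum is just \<open>k\<close>.\<close>
  proof (cases "c = 1")
    case True
    then have "int (p ^ Suc d) dvd int k" using Suc.prems(2) by simp
    then show ?thesis by (simp only: of_nat_dvd_iff)
  next
    case False
    obtain x where c: "c = 1 + int p * x"
      using Suc.prems(1) by (metis add.commute diff_add_cancel dvdE)
    have factor: "(\<Sum>i<k. c ^ i) = (\<Sum>i<p. c ^ i) * (\<Sum>i<k'. (c ^ p) ^ i)"
    proof -
      have "(c - 1) * (\<Sum>i<k. c ^ i) = (c ^ p) ^ k' - 1"
        by (simp add: power_diff_1_eq[symmetric] k power_mult)
      also have "\<dots> = (c ^ p - 1) * (\<Sum>i<k'. (c ^ p) ^ i)" by (rule power_diff_1_eq)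
      also have "c ^ p - 1 = (c - 1) * (\<Sum>i<p. c ^ i)" by (rule power_diff_1_eq)
      finally show ?thesis using False by simp
    qed
    have nodvd: "\<not> (int p)\<^sup>2 dvd (\<Sum>i<p. c ^ i)"
    proof
      assume "(int p)\<^sup>2 dvd (\<Sum>i<p. c ^ i)"
      then have "(int p)\<^sup>2 dvd 2 * int p + int p * x * (int p * (int p - 1))"
        using cong_dvd_iff[OF geometric_sum_mod_square[OF c, of p]] by simp
      moreover have "int p * x * (int p * (int p - 1)) = (int p)\<^sup>2 * (x * (int p - 1))"
        by (simp add: power2_eq_square)
      ultimately have "(int p)\<^sup>2 dvd 2 * int p" by (simp add: dvd_add_left_iff)
      then have "int p dvd 2" using \<open>p > 2\<close> by (simp add: power2_eq_square)
      then show False using \<open>p > 2\<close> by (auto dest: zdvd_imp_le)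
    qed
    have "[(\<Sum>i<p. c ^ i) = (\<Sum>i<p. 1 ^ i)] (mod int p)"
      using Suc.prems by (intro cong_sum cong_pow) (simp add: cong_iff_dvd_diff)
    then have "int p dvd (\<Sum>i<p. c ^ i)" by (simp add: cong_dvd_iff)
    then obtain u where u: "(\<Sum>i<p. c ^ i) = int p * u" by (rule dvdE)
    have "\<not> int p dvd u" using nodvd u by (auto simp: power2_eq_square)
    then have "coprime (int p ^ d) u"
      using prime by (simp add: prime_imp_coprime)
    moreover have "int p ^ d dvd u * (\<Sum>i<k'. (c ^ p) ^ i)"
      using Suc.prems(2) \<open>p > 2\<close> by (simp add: factor u mult.assoc)
    ultimately have "int p ^ d dvd (\<Sum>i<k'. (c ^ p) ^ i)"
      by (simp add: coprime_dvd_mult_right_iff)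
    moreover have "int p dvd c ^ p - 1"
      using Suc.prems(1) power_diff_1_eq[of c p] by simp
    ultimately have "p ^ d dvd k'" using Suc.IH by blast
    then show ?thesis using k by simp
  qed
qed simp

section \<open>Roots of unity with integral trace\<close>

text \<open>Here \<epsilon> is a root of X^2 - t X + 1 with |t| at most 2. The five values of
  \<open>t\<close> give the orders 1, 2, 3, 4 and 6, all divisors of 12.\<close>

lemma root_of_unity_if_int_trace:
  fixes \<epsilon> :: complex and t :: int
  assumes "cmod \<epsilon> = 1" "\<epsilon> + cnj \<epsilon> = of_int t"
  shows "\<epsilon> ^ 12 = 1"
proof -
  have norm: "\<epsilon> * cnj \<epsilon> = 1" using assms(1) by (simp add: complex_norm_square[symmetric])
  have "of_int t = 2 * Re \<epsilon>" using assms(2) by (simp add: complex_eq_iff)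
  then have "\<bar>real_of_int t\<bar> \<le> 2" using abs_Re_le_cmod[of \<epsilon>] assms(1) by linarith
  then have "t \<in> {-2, -1, 0, 1, 2}" by auto
  have quad: "\<epsilon> * \<epsilon> = of_int t * \<epsilon> - 1"
  proof -
    have "of_int t * \<epsilon> = \<epsilon> * \<epsilon> + \<epsilon> * cnj \<epsilon>"
      by (simp only: assms(2)[symmetric]) (simp add: algebra_simps)
    then show ?thesis using norm by simp
  qed
  have cube: "\<epsilon> ^ 3 = of_int t * (of_int t * \<epsilon> - 1) - \<epsilon>"
  proof -
    have "\<epsilon> ^ 3 = (of_int t * \<epsilon> - 1) * \<epsilon>" by (simp add: power3_eq_cube quad)
    also have "\<dots> = of_int t * (\<epsilon> * \<epsilon>) - \<epsilon>" by (simp add: left_diff_distrib)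
    finally show ?thesis by (simp only: quad)
  qed
  have twelve: "\<epsilon> ^ 12 = (\<epsilon> ^ 3) ^ 4" "\<epsilon> ^ 12 = (\<epsilon> * \<epsilon>) ^ 6"
    by (simp_all flip: power_mult power2_eq_square)
  from \<open>t \<in> _\<close> consider "t = 2" | "t = -2" | "t = 0" | "t = 1" | "t = -1" by blast
  then show ?thesis
  proof cases
    case 1
    then have "(\<epsilon> - 1)\<^sup>2 = 0" using quad by (simp add: power2_eq_square algebra_simps)
    then show ?thesis by simp
  next
    case 2
    have "(\<epsilon> + 1)\<^sup>2 = \<epsilon> * \<epsilon> + 2 * \<epsilon> + 1"
      by (simp add: power2_eq_square algebra_simps)
    then have "(\<epsilon> + 1)\<^sup>2 = 0" using 2 quad by simp
    then have "\<epsilon> = - 1" by (simp add: add_eq_0_iff2)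
    then show ?thesis by simp
  next
    case 3
    then show ?thesis using quad by (simp add: twelve(2))
  qed (use cube in \<open>simp_all add: twelve(1)\<close>)
qed

section \<open>Reduction of an imaginary quadratic order modulo an integer\<close>

text \<open>\<open>w\<close> generates an imaginary quadratic order, and \<open>W\<close> is a root modulo \<open>m\<close> of its minimal
  polynomial. In \<open>reduces z Z Z'\<close>, the numbers \<open>Z\<close> and \<open>Z'\<close> are the images of \<open>z\<close> under
  the two ring homomorphisms to the integers modulo \<open>m\<close> that send \<open>w\<close> to \<open>W\<close> and to \<open>1 - W\<close>.\<close>

locale quadratic_reduction =
  fixes w :: complex and c W m :: int
  assumes w_square: "w * w = w - of_int c"
    and w_cnj: "cnj w = 1 - w"
    and w_nonreal: "Im w \<noteq> 0"
    and W_square: "[W * W = W - c] (mod m)"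
begin

definition reduces :: "complex \<Rightarrow> int \<Rightarrow> int \<Rightarrow> bool" where
  "reduces z Z Z' \<longleftrightarrow> (\<exists>x y. z = of_int x + of_int y * w \<and>
     [Z = x + y * W] (mod m) \<and> [Z' = x + y * (1 - W)] (mod m))"

text \<open>Since \<open>w\<close> is not real, the coordinates of \<open>z\<close> are unique, so
  its image is well defined modulo \<open>m\<close>.\<close>

lemma reduces_unique:
  assumes "reduces z Z Z'" "reduces z Y Y'"
  shows "[Z = Y] (mod m)"
proof -
  obtain x1 y1 x2 y2 where 1: "z = of_int x1 + of_int y1 * w" "[Z = x1 + y1 * W] (mod m)"
    and 2: "z = of_int x2 + of_int y2 * w" "[Y = x2 + y2 * W] (mod m)"
    using assms unfolding reduces_def by blast
  have "Im z = of_int y1 * Im w" by (simp add: 1(1))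
  moreover have "Im z = of_int y2 * Im w" by (simp add: 2(1))
  ultimately have "y1 = y2" using w_nonreal by simp
  then have "x1 = x2" using 1 2 by simp
  with \<open>y1 = y2\<close> show ?thesis using 1 2 by (metis cong_sym cong_trans)
qed

text \<open>Conjugation sends \<open>w\<close> to \<open>1 - w\<close> and thus exchanges the two
  homomorphisms.\<close>

lemma reduces_cnj: "reduces z Z Z' \<Longrightarrow> reduces (cnj z) Z' Z"
  unfolding reduces_def
proof (elim exE conjE)
  fix x y
  assume "z = of_int x + of_int y * w" "[Z = x + y * W] (mod m)" "[Z' = x + y * (1 - W)] (mod m)"
  then show "\<exists>x y. cnj z = of_int x + of_int y * w \<and>
      [Z' = x + y * W] (mod m) \<and> [Z = x + y * (1 - W)] (mod m)"
    by (intro exI[of _ "x + y"] exI[of _ "- y"]) (simp add: w_cnj algebra_simps)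
qed

lemma reduces_mult:
  assumes "reduces z Z Z'" "reduces u U U'"
  shows "reduces (z * u) (Z * U) (Z' * U')"
proof -
  obtain x1 y1 x2 y2 where 1: "z = of_int x1 + of_int y1 * w"
      "[Z = x1 + y1 * W] (mod m)" "[Z' = x1 + y1 * (1 - W)] (mod m)"
    and 2: "u = of_int x2 + of_int y2 * w"
      "[U = x2 + y2 * W] (mod m)" "[U' = x2 + y2 * (1 - W)] (mod m)"
    using assms unfolding reduces_def by blast
  define x y where "x = x1 * x2 - y1 * y2 * c" and "y = x1 * y2 + x2 * y1 + y1 * y2"
  have "z * u = of_int (x1 * x2) + of_int (x1 * y2 + x2 * y1) * w + of_int (y1 * y2) * (w * w)"
    by (simp add: 1 2 algebra_simps)
  then have "z * u = of_int x + of_int y * w"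
    by (simp add: w_square x_def y_def algebra_simps)
  \<comment> \<open>Both \<open>W\<close> and \<open>1 - W\<close> are roots of X^2 - X + c modulo
    \<open>m\<close>, so one computation with \<open>V\<close> serves both components.\<close>
  moreover have product: "[(x1 + y1 * V) * (x2 + y2 * V) = x + y * V] (mod m)"
    if "[V * V = V - c] (mod m)" for V
  proof -
    have "(x1 + y1 * V) * (x2 + y2 * V) = x1 * x2 + (x1 * y2 + x2 * y1) * V + y1 * y2 * (V * V)"
      by (simp add: algebra_simps)
    also have "[\<dots> = x1 * x2 + (x1 * y2 + x2 * y1) * V + y1 * y2 * (V - c)] (mod m)"
      by (intro cong_add cong_mult that cong_refl)
    also have "x1 * x2 + (x1 * y2 + x2 * y1) * V + y1 * y2 * (V - c) = x + y * V"
      by (simp add: x_def y_def algebra_simps)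
    finally show ?thesis .
  qed
  have "[(1 - W) * (1 - W) = (1 - W) - c] (mod m)"
    using W_square by (simp add: cong_iff_dvd_diff algebra_simps)
  then have "[Z' * U' = x + y * (1 - W)] (mod m)"
    using 1 2 product cong_mult cong_trans by blast
  moreover have "[Z * U = x + y * W] (mod m)"
    using 1 2 product W_square cong_mult cong_trans by blast
  ultimately show ?thesis unfolding reduces_def by blast
qed

lemma reduces_power: "reduces z Z Z' \<Longrightarrow> reduces (z ^ k) (Z ^ k) (Z' ^ k)"
proof (induction k)
  case 0
  show ?case unfolding reduces_def by (intro exI[of _ 1] exI[of _ 0]) simp
qed (simp add: reduces_mult)

lemma reduces_trace:
  assumes "reduces z Z Z'"
  obtains t where "z + cnj z = of_int t" "[t = Z + Z'] (mod m)"
proof -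
  obtain x y where xy: "z = of_int x + of_int y * w"
      "[Z = x + y * W] (mod m)" "[Z' = x + y * (1 - W)] (mod m)"
    using assms unfolding reduces_def by blast
  have "z + cnj z = of_int (2 * x + y)" using xy by (simp add: w_cnj algebra_simps)
  moreover have "[Z + Z' = (x + y * W) + (x + y * (1 - W))] (mod m)"
    using xy by (intro cong_add)
  then have "[2 * x + y = Z + Z'] (mod m)"
    by (simp add: cong_sym_eq algebra_simps)
  ultimately show ?thesis using that by blast
qed

text \<open>The quotient of \<open>\<alpha> ^ k\<close> and \<open>\<beta> ^ n\<close> has absolute value 1, and it has integral trace because
  \<open>p ^ (n * k)\<close> divides the trace of \<open>\<alpha> ^ k * cnj \<beta> ^ n\<close>; so no ideal theory is needed
  to see that it is a root of unity.\<close>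

lemma powers_congruent:
  fixes p n k :: nat
  assumes "reduces \<alpha> A A'" "reduces \<beta> B B'" "p > 0" "m = int p ^ (n * k)"
    and \<alpha>: "\<alpha> * cnj \<alpha> = of_nat p ^ n" and \<beta>: "\<beta> * cnj \<beta> = of_nat p ^ k"
    and "int p ^ n dvd A" "int p ^ k dvd B"
  shows "[A' ^ (12 * k) = B' ^ (12 * n)] (mod m)"
proof -
  \<comment> \<open>With \<open>q\<close> the norm of \<open>\<beta> ^ n\<close>, the quotient of
    \<open>\<alpha> ^ k\<close> by \<open>\<beta> ^ n\<close> is \<open>z / q\<close>.\<close>
  define z where "z = \<alpha> ^ k * cnj \<beta> ^ n"
  define q :: real where "q = real p ^ (n * k)"
  have "q > 0" using assms by (simp add: q_def)
  have "reduces z (A ^ k * B' ^ n) (A' ^ k * B ^ n)"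
    unfolding z_def using assms by (intro reduces_mult reduces_power reduces_cnj)
  then obtain t where t: "z + cnj z = of_int t" "[t = A ^ k * B' ^ n + A' ^ k * B ^ n] (mod m)"
    by (rule reduces_trace)
  have "m dvd A ^ k" "m dvd B ^ n"
    using dvd_power_same[OF assms(7), of k] dvd_power_same[OF assms(8), of n]
    by (simp_all add: assms(4) power_mult[symmetric] mult.commute)
  then have "m dvd t" using cong_dvd_iff[OF t(2)] by simp
  then obtain s where s: "t = m * s" by (rule dvdE)
  have "z * cnj z = (\<alpha> * cnj \<alpha>) ^ k * (\<beta> * cnj \<beta>) ^ n"
    by (simp add: z_def power_mult_distrib ac_simps)
  also have "\<dots> = of_real (q\<^sup>2)"
    by (simp add: \<alpha> \<beta> q_def power_mult[symmetric] power2_eq_square mult.commute)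
  finally have "of_real ((cmod z)\<^sup>2) = (of_real (q\<^sup>2) :: complex)"
    by (simp only: complex_norm_square)
  then have "(cmod z)\<^sup>2 = q\<^sup>2" by (simp only: of_real_eq_iff)
  then have "cmod z = q" using \<open>q > 0\<close> by (simp add: power2_eq_iff_nonneg)
  then have "cmod (z / of_real q) = 1" using \<open>q > 0\<close> by (simp add: norm_divide)
  moreover have "z / of_real q + cnj (z / of_real q) = of_int s"
  proof -
    have "z / of_real q + cnj (z / of_real q) = of_int t / of_real q"
      using t(1) by (simp add: add_divide_distrib[symmetric])
    also have "(of_int t :: complex) = of_real q * of_int s"
      by (simp add: s assms(4) q_def)
    finally show ?thesis using \<open>q > 0\<close> by simp
  qed
  ultimately have "(z / of_real q) ^ 12 = 1" by (rule root_of_unity_if_int_trace)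
  then have z12: "z ^ 12 = of_real q ^ 12" using \<open>q > 0\<close> by (simp add: power_divide)
  have "of_real q = (\<beta> * cnj \<beta>) ^ n"
    by (simp add: \<beta> q_def power_mult[symmetric] mult.commute)
  then have "\<alpha> ^ (12 * k) * cnj \<beta> ^ (12 * n) = \<beta> ^ (12 * n) * cnj \<beta> ^ (12 * n)"
    using z12 by (simp add: z_def power_mult_distrib power_mult[symmetric] mult.commute)
  moreover have "cnj \<beta> \<noteq> 0" using \<beta> \<open>p > 0\<close> by auto
  ultimately have "\<alpha> ^ (12 * k) = \<beta> ^ (12 * n)" by simp
  \<comment> \<open>Conjugating brings \<open>A'\<close> and \<open>B'\<close> into the first
    component, the one that \<open>reduces_unique\<close> compares.\<close>
  moreover have "reduces (cnj \<alpha> ^ (12 * k)) (A' ^ (12 * k)) (A ^ (12 * k))"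
      "reduces (cnj \<beta> ^ (12 * n)) (B' ^ (12 * n)) (B ^ (12 * n))"
    using assms(1,2) by (auto intro!: reduces_power reduces_cnj)
  ultimately show ?thesis
    by (metis reduces_unique complex_cnj_power)
qed

text \<open>As \<open>w\<close> has trace 1, the first assumption says that \<alpha> has trace 1.
  Its conjugate is therefore 1 - \<alpha>, with image \<open>1 - A\<close>; the third assumption
  gives its norm.\<close>

lemma reduces_trace_one:
  assumes "2 * r + a = 1" "[A = r + a * W] (mod m)" "r\<^sup>2 + r * a + a\<^sup>2 * c = N"
  defines "\<alpha> \<equiv> of_int r + of_int a * w"
  shows "reduces \<alpha> A (1 - A)" "\<alpha> * cnj \<alpha> = of_int N" "[A * (1 - A) = N] (mod m)"
proof -
  have "[1 - A = 1 - (r + a * W)] (mod m)" using assms(2) by (intro cong_diff cong_refl)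
  also have "1 - (r + a * W) = r + a * (1 - W)" using assms(1) by (simp add: algebra_simps)
  finally show red: "reduces \<alpha> A (1 - A)"
    using assms(2) unfolding reduces_def \<alpha>_def by blast
  have "\<alpha> * cnj \<alpha> = of_int (r\<^sup>2 + r * a) + of_int (a\<^sup>2) * (w - w * w)"
    by (simp add: \<alpha>_def w_cnj algebra_simps power2_eq_square)
  also have "\<dots> = of_int N" by (simp add: w_square assms(3)[symmetric])
  finally show norm: "\<alpha> * cnj \<alpha> = of_int N" .
  have "reduces (of_int N) (A * (1 - A)) ((1 - A) * A)"
    using reduces_mult[OF red reduces_cnj[OF red]] norm by simp
  moreover have "reduces (of_int N) N N"
    unfolding reduces_def by (intro exI[of _ N] exI[of _ 0]) simp
  ultimately show "[A * (1 - A) = N] (mod m)" by (rule reduces_unique)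
qed

end

section \<open>The divisibility relation between the exponents\<close>

lemma prime_power_dvd_if_dvd_mult_diff_one:
  fixes p A :: int
  assumes "Factorial_Ring.prime p" "p dvd A" "p ^ n dvd A * (1 - A)"
  shows "p ^ n dvd A"
proof -
  have "\<not> p dvd 1 - A"
    using assms by (metis diff_add_cancel dvd_add not_prime_unit)
  then have "coprime (p ^ n) (1 - A)" using assms(1) by (simp add: prime_imp_coprime)
  then show ?thesis using assms(3) by (simp add: coprime_dvd_mult_left_iff)
qed

text \<open>Modulo \<open>p\<close> the left side of the equation is -1.\<close>

lemma not_prime_dvd_if_norm:
  fixes p g a :: int
  assumes "Factorial_Ring.prime p" "4 * p ^ n - 1 = g * a\<^sup>2" "0 < n"
  shows "\<not> p dvd a"
proof
  assume "p dvd a"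
  then have "p dvd 4 * p ^ n - 1" unfolding assms(2) by (simp add: power2_eq_square)
  moreover have "p dvd 4 * p ^ n" using \<open>0 < n\<close> by simp
  ultimately have "p dvd 1" by (metis dvd_diff_right_iff)
  then show False using assms(1) not_prime_unit by blast
qed

text \<open>Since \<open>p ^ n\<close> divides the image \<open>A\<close> of \<alpha>, the
  congruence of powers makes (1 - B)^(12 n) equal to 1 modulo \<open>p ^ n\<close>. The factor (1 -
  B) - 1 accounts for exactly \<open>p ^ k\<close>, so the geometric sum of length
  \<open>12 * n\<close> carries the remaining \<open>p ^ (n - k)\<close>.\<close>

lemma prime_power_diff_dvd:
  fixes p n k :: nat and g a b :: int
  assumes p: "Factorial_Ring.prime p" "odd p" and k: "0 < k" "k < n"
    and a: "4 * int p ^ n - 1 = g * a\<^sup>2" and b: "4 * int p ^ k - 1 = g * b\<^sup>2"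
  shows "p ^ (n - k) dvd 12 * n"
proof -
  have prime: "Factorial_Ring.prime (int p)" using p by simp
  have "p > 2" using p by (metis even_numeral nat_less_le prime_ge_2_nat)
  have "odd (g * a\<^sup>2)" "odd (g * b\<^sup>2)" by (simp_all flip: a b)
  then have "odd a" "odd b" by simp_all
  \<comment> \<open>With w = (1 + sqrt(-g)) / 2, the number (1 + a sqrt(-g)) / 2 equals r + a w;
    likewise for \<open>s\<close> and \<open>b\<close>.\<close>
  define r s where "r = (1 - a) div 2" and "s = (1 - b) div 2"
  then have r: "2 * r + a = 1" and s: "2 * s + b = 1"
    using \<open>odd a\<close> \<open>odd b\<close> by simp_all
  \<comment> \<open>This makes \<open>w\<close> integral: w^2 - w + (1 + g) / 4 = 0.\<close>
  have "4 dvd 1 + g"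
  proof -
    have "a = 1 - 2 * r" using r by simp
    have "g * a\<^sup>2 = g + 4 * (g * r\<^sup>2 - g * r)"
      unfolding \<open>a = 1 - 2 * r\<close> by (simp add: power2_eq_square algebra_simps)
    then have "1 + g = 4 * (int p ^ n + g * r - g * r\<^sup>2)"
      using a by (simp add: algebra_simps)
    then show ?thesis by simp
  qed
  then obtain c where c: "1 + g = 4 * c" by (rule dvdE)
  have norm: "x\<^sup>2 + x * y + y\<^sup>2 * c = N"
    if "2 * x + y = 1" "4 * N - 1 = g * y\<^sup>2" for x y N
  proof -
    have "4 * (x\<^sup>2 + x * y + y\<^sup>2 * c) = (2 * x + y)\<^sup>2 - y\<^sup>2 + y\<^sup>2 * (4 * c)"
      by (simp add: power2_eq_square algebra_simps)
    also have "\<dots> = 4 * N"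
      unfolding that(1) c[symmetric] using that(2) by (simp add: algebra_simps)
    finally show ?thesis by simp
  qed
  note norm_a = norm[OF r a] and norm_b = norm[OF s b]
  have "g > 0"
  proof -
    have "1 \<le> int p ^ n" using \<open>p > 2\<close> by (intro one_le_power) simp
    then have "g * a\<^sup>2 > 0" by (simp flip: a)
    then show ?thesis by (simp add: zero_less_mult_iff)
  qed
  \<comment> \<open>The common norm of \<open>\<alpha> ^ k\<close> and
    \<open>\<beta> ^ n\<close>.\<close>
  define m where "m = int p ^ (n * k)"
  have "n * 1 \<le> n * k" using k by (intro mult_le_mono) auto
  then have dvd_m: "int p ^ n dvd m" "int p ^ k dvd m" "int p ^ (k + 1) dvd m"
    unfolding m_def using k by (intro le_imp_power_dvd; linarith)+
  \<comment> \<open>A root modulo \<open>m\<close> of X^2 - X + p^n, whose complex roots are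
    \<alpha> and its conjugate. Taking the root divisible by \<open>p\<close> amounts to choosing
    the prime P above \<open>p\<close>.\<close>
  obtain A where A: "int p dvd A" "m dvd A\<^sup>2 - A + int p ^ n"
    using root_mod_prime_power[of "int p" "int p ^ n" "n * k"] k unfolding m_def by auto
  have "\<not> int p dvd a" using not_prime_dvd_if_norm[OF prime a] k by simp
  then have "coprime (int p) a" using prime by (simp add: prime_imp_coprime)
  then have "coprime a m" unfolding m_def by (simp add: coprime_commute)
  then obtain a' where a': "[a * a' = 1] (mod m)" by (meson cong_solve_coprime_int)
  \<comment> \<open>Chosen so that r + a W is \<open>A\<close> modulo \<open>m\<close>;
    \<open>a\<close> is invertible there.\<close>
  define W where "W = a' * (A - r)"
  have "[a * W = 1 * (A - r)] (mod m)"
    unfolding W_def mult.assoc[symmetric] using a' by (rule cong_scalar_right)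
  then have aW: "m dvd a * W - (A - r)" by (simp add: cong_iff_dvd_diff)
  have W: "[W * W = W - c] (mod m)"
  proof -
    have "a\<^sup>2 * (W * W - (W - c)) =
        (a * W - (A - r)) * (a * W + (A - r) - a) + ((A - r)\<^sup>2 - a * (A - r) + a\<^sup>2 * c)"
      by (simp add: power2_eq_square algebra_simps)
    also have "(A - r)\<^sup>2 - a * (A - r) + a\<^sup>2 * c
        = A\<^sup>2 - (2 * r + a) * A + (r\<^sup>2 + r * a + a\<^sup>2 * c)"
      by (simp add: power2_eq_square algebra_simps)
    also have "\<dots> = A\<^sup>2 - A + int p ^ n" by (simp only: r norm_a mult_1)
    finally have "m dvd a\<^sup>2 * (W * W - (W - c))"
      using aW A(2) by simp
    moreover have "coprime m (a\<^sup>2)" using \<open>coprime a m\<close> by (simp add: coprime_commute)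
    ultimately show ?thesis by (simp add: cong_iff_dvd_diff coprime_dvd_mult_right_iff)
  qed
  define w where "w = Complex (1 / 2) (sqrt (of_int g) / 2)"
  have "of_int (4 * c) = 1 + (of_int g :: real)" by (simp flip: c)
  then have "w * w = w - of_int c"
    using \<open>g > 0\<close> by (simp add: w_def complex_eq_iff field_simps)
  moreover have "cnj w = 1 - w" "Im w \<noteq> 0"
    using \<open>g > 0\<close> by (simp_all add: w_def complex_eq_iff)
  ultimately interpret quadratic_reduction w c W m
    using W by unfold_locales
  define \<alpha> where "\<alpha> = of_int r + of_int a * w"
  have "[A = r + a * W] (mod m)"
    using aW by (simp add: cong_iff_dvd_diff dvd_diff_commute algebra_simps)
  from reduces_trace_one[OF r this norm_a]
  have \<alpha>: "reduces \<alpha> A (1 - A)" "\<alpha> * cnj \<alpha> = of_nat p ^ n" "[A * (1 - A) = int p ^ n] (mod m)"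
    by (simp_all add: \<alpha>_def)
  obtain \<beta> B where \<beta>: "reduces \<beta> B (1 - B)" "\<beta> * cnj \<beta> = of_nat p ^ k"
      "[B * (1 - B) = int p ^ k] (mod m)" and "int p dvd B"
  proof -
    define \<gamma> C where "\<gamma> = of_int s + of_int b * w" and "C = s + b * W"
    have \<gamma>: "reduces \<gamma> C (1 - C)" "\<gamma> * cnj \<gamma> = of_nat p ^ k" "[C * (1 - C) = int p ^ k] (mod m)"
      using reduces_trace_one[OF s cong_refl norm_b] by (simp_all add: \<gamma>_def C_def)
    have "int p dvd C * (1 - C)"
      using \<gamma>(3) dvd_m(2) k by (metis cong_dvd_iff cong_dvd_modulus dvd_power dvd_trans)
    then consider "int p dvd C" | "int p dvd 1 - C" using prime by (auto simp: prime_dvd_mult_iff)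
    then show ?thesis
    proof cases
      case 1
      then show ?thesis using that \<gamma> by blast
    next
      \<comment> \<open>Here the conjugate of \<gamma> is the one lying in P, so it is taken as
        \<beta>.\<close>
      case 2
      have "reduces (cnj \<gamma>) (1 - C) (1 - (1 - C))" using reduces_cnj[OF \<gamma>(1)] by simp
      moreover have "cnj \<gamma> * cnj (cnj \<gamma>) = of_nat p ^ k" using \<gamma>(2) by (simp add: mult.commute)
      moreover have "[(1 - C) * (1 - (1 - C)) = int p ^ k] (mod m)"
        using \<gamma>(3) by (simp add: mult.commute)
      ultimately show ?thesis using that 2 by blast
    qed
  qed
  have "int p ^ n dvd A * (1 - A)" using \<alpha>(3) dvd_m(1) by (metis cong_dvd_iff cong_dvd_modulus dvd_refl)
  then have A_dvd: "int p ^ n dvd A"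
    using prime A(1) prime_power_dvd_if_dvd_mult_diff_one by blast
  have "int p ^ k dvd B * (1 - B)" using \<beta>(3) dvd_m(2) by (metis cong_dvd_iff cong_dvd_modulus dvd_refl)
  then have B_dvd: "int p ^ k dvd B"
    using prime \<open>int p dvd B\<close> prime_power_dvd_if_dvd_mult_diff_one by blast
  then obtain u where u: "B = int p ^ k * u" by (rule dvdE)
  \<comment> \<open>The norm is exactly \<open>p ^ k\<close>, and \<open>m\<close> is divisible by
    \<open>p ^ (k + 1)\<close>, so the congruence for \<open>B * (1 - B)\<close> detects one further
    factor \<open>p\<close>.\<close>
  have "\<not> int p dvd u"
  proof
    assume "int p dvd u"
    then have "int p ^ (k + 1) dvd B * (1 - B)" by (auto simp: u)
    then have "int p ^ (k + 1) dvd int p ^ k"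
      using \<beta>(3) dvd_m(3) by (metis cong_dvd_iff cong_dvd_modulus)
    then show False using \<open>p > 2\<close> by (auto dest: power_dvd_imp_le)
  qed
  then have "coprime (int p ^ (n - k)) (- u)" using prime by (simp add: prime_imp_coprime)
  have "[(1 - A) ^ (12 * k) = (1 - B) ^ (12 * n)] (mod m)"
    using powers_congruent[OF \<alpha>(1) \<beta>(1) _ m_def \<alpha>(2) \<beta>(2) A_dvd B_dvd] \<open>p > 2\<close> by simp
  then have "[(1 - A) ^ (12 * k) = (1 - B) ^ (12 * n)] (mod int p ^ n)"
    using dvd_m(1) by (rule cong_dvd_modulus)
  moreover have "[(1 - A) ^ (12 * k) = 1 ^ (12 * k)] (mod int p ^ n)"
    using A_dvd by (intro cong_pow) (simp add: cong_iff_dvd_diff)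
  ultimately have "[(1 - B) ^ (12 * n) = 1] (mod int p ^ n)"
    by (metis cong_sym cong_trans power_one)
  then have "int p ^ n dvd (1 - B - 1) * (\<Sum>i<12 * n. (1 - B) ^ i)"
    by (simp only: cong_iff_dvd_diff power_diff_1_eq)
  also have "(1 - B - 1) * (\<Sum>i<12 * n. (1 - B) ^ i)
      = int p ^ k * (- u * (\<Sum>i<12 * n. (1 - B) ^ i))"
    by (simp add: u)
  also have "int p ^ n = int p ^ k * int p ^ (n - k)"
    using k by (simp add: power_add[symmetric])
  finally have "int p ^ (n - k) dvd - u * (\<Sum>i<12 * n. (1 - B) ^ i)"
    using \<open>p > 2\<close> by simp
  then have "int p ^ (n - k) dvd (\<Sum>i<12 * n. (1 - B) ^ i)"
    using \<open>coprime _ (- u)\<close> by (simp only: coprime_dvd_mult_right_iff)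
  moreover have "int p dvd (1 - B) - 1" using \<open>int p dvd B\<close> by simp
  ultimately show ?thesis using prime_power_dvd_geometric_sum[OF p] by blast
qed

section \<open>Size estimate and conclusion\<close>

text \<open>Eliminating \<open>g\<close> shows that \<open>p ^ k\<close> divides (a - b)(a + b).
  Since \<open>p\<close> does not divide 2 a, one factor takes the whole power, so
  \<open>p ^ k\<close> is at most 2 a, while a^2 is below 4 p^n.\<close>

lemma exponent_gap:
  fixes p n k :: nat and g a b :: int
  assumes p: "Factorial_Ring.prime p" "odd p" and k: "0 < k" "k < n"
    and a: "4 * int p ^ n - 1 = g * a\<^sup>2" and b: "4 * int p ^ k - 1 = g * b\<^sup>2"
    and "a > 0" "b > 0"
  shows "2 * k < n + 3"
proof -
  have prime: "Factorial_Ring.prime (int p)" using p by simp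
  have "p > 2" using p by (metis even_numeral nat_less_le prime_ge_2_nat)
  have pk: "int p ^ k < int p ^ n" using k \<open>p > 2\<close> by (intro power_strict_increasing) auto
  have "int p ^ k \<ge> 1" using \<open>p > 2\<close> by (intro one_le_power) auto
  then have "g * b\<^sup>2 > 0" "g * b\<^sup>2 < g * a\<^sup>2" using pk by (simp_all flip: a b)
  then have "g > 0" by (simp add: zero_less_mult_iff)
  then have "b < a" using \<open>g * b\<^sup>2 < g * a\<^sup>2\<close> \<open>a > 0\<close> by (simp add: power2_less_imp_less)
  have "b\<^sup>2 * (4 * int p ^ n - 1) = a\<^sup>2 * (4 * int p ^ k - 1)" unfolding a b by simp
  then have "(a - b) * (a + b) = 4 * (a\<^sup>2 * int p ^ k - b\<^sup>2 * int p ^ n)"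
    by (simp add: power2_eq_square algebra_simps)
  then have dvd: "int p ^ k dvd (a - b) * (a + b)"
    using k by (simp add: le_imp_power_dvd)
  have "\<not> int p dvd a" using not_prime_dvd_if_norm[OF prime a] k by simp
  have "\<not> (int p dvd a - b \<and> int p dvd a + b)"
  proof
    assume "int p dvd a - b \<and> int p dvd a + b"
    then have "int p dvd (a - b) + (a + b)" using dvd_add by blast
    then have "int p dvd 2 * a" by simp
    then have "int p dvd 2" using prime \<open>\<not> int p dvd a\<close> by (simp add: prime_dvd_mult_iff)
    then show False using \<open>p > 2\<close> by (auto dest: zdvd_imp_le)
  qed
  then consider "coprime (int p ^ k) (a - b)" | "coprime (int p ^ k) (a + b)"
    using prime by (auto simp: prime_imp_coprime)
  then have "int p ^ k dvd a - b \<or> int p ^ k dvd a + b"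
    using dvd by cases (simp_all add: coprime_dvd_mult_left_iff coprime_dvd_mult_right_iff)
  then have "int p ^ k \<le> 2 * a"
    using \<open>b > 0\<close> \<open>b < a\<close> by (auto dest!: zdvd_imp_le)
  then have "(int p ^ k)\<^sup>2 \<le> (2 * a)\<^sup>2" by (intro power_mono) auto
  also have "\<dots> \<le> 4 * (g * a\<^sup>2)" 
    using \<open>g > 0\<close> mult_right_mono[of 1 g "a\<^sup>2"] by (simp add: power_mult_distrib)
  also have "\<dots> < 16 * int p ^ n" by (simp flip: a)
  \<comment> \<open>The 3 in the conclusion comes from absorbing 16 into p^3, which is at least
    27.\<close>
  also have "\<dots> \<le> int p ^ 3 * int p ^ n"
  proof -
    have "(3::int) ^ 3 \<le> int p ^ 3" using \<open>p > 2\<close> by (intro power_mono) auto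
    then show ?thesis by (intro mult_right_mono) auto
  qed
  finally have "int p ^ (2 * k) < int p ^ (n + 3)"
    by (simp add: power_add power_mult[symmetric] mult.commute)
  then show ?thesis using \<open>p > 2\<close> by (auto dest: power_less_imp_less_exp)
qed

lemma quadratic_field_exponents_not_less:
  fixes p n k :: nat
  assumes p: "Factorial_Ring.prime p" "odd p" and k: "8 < k" "k < n"
    and eq: "quadratic_field (1 - 4 * int p ^ n) = quadratic_field (1 - 4 * int p ^ k)"
  shows False
proof -
  have "p \<ge> 3" using p by (metis even_numeral nat_less_le prime_ge_2_nat Suc_leI numeral_3_eq_3 numeral_2_eq_2)
  have pos: "4 * int p ^ j - 1 > 0" for j
  proof -
    have "1 \<le> int p ^ j" using \<open>p \<ge> 3\<close> by (intro one_le_power) simp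
    then show ?thesis by linarith
  qed
  have "sqrt (of_int (4 * int p ^ n - 1)) * sqrt (of_int (4 * int p ^ k - 1)) \<in> \<rat>"
    using eq pos by (intro quadratic_field_eq_imp_Rats) simp_all
  then obtain g a b where gab: "4 * int p ^ n - 1 = g * a\<^sup>2" "4 * int p ^ k - 1 = g * b\<^sup>2"
      "a > 0" "b > 0"
    using Rats_sqrt_mult_sqrt_imp_common_factor[OF pos pos] by metis
  have "0 < k" using k by simp
  define d where "d = n - k"
  have "2 * k < n + 3" using exponent_gap[OF p \<open>0 < k\<close> k(2) gab] .
  \<comment> \<open>The gap gives k <= d + 2. With k >= 9 this yields d >= 7, and n = d + k is at
    most 2 d + 2, so 12 n is too small to be a multiple of \<open>p ^ d\<close>.\<close>
  then have "d \<ge> 7" "n \<le> 2 * d + 2" using k by (auto simp: d_def)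
  have "p ^ d dvd 12 * n"
    unfolding d_def by (rule prime_power_diff_dvd[OF p \<open>0 < k\<close> k(2) gab(1,2)])
  then have "p ^ d \<le> 12 * n" using k by (intro dvd_imp_le) auto
  moreover have "3 ^ d \<le> p ^ d" using \<open>p \<ge> 3\<close> by (intro power_mono) auto
  moreover have "24 * d + 24 < 3 ^ d"
    using \<open>d \<ge> 7\<close> by (induction d rule: dec_induct) auto
  ultimately show False using \<open>n \<le> 2 * d + 2\<close> by simp
qed

theorem theorem1p12:
  fixes p n1 n2 :: nat
  assumes "Factorial_Ring.prime p" and "odd p"
    and "n1 > 8" and "n2 > 8"
    and "quadratic_field (1 - 4 * int p ^ n1) = quadratic_field (1 - 4 * int p ^ n2)"
  shows "n1 = n2"
  using quadratic_field_exponents_not_less[OF assms(1,2)] assms(3-5)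
  by (metis nat_neq_iff)

end
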